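(* Let $n>1$ and let $f:\mathbb{R}^n\to\mathbb{R}$ be convex and twice differentiable with Lipschitz continuous gradient and with $2L$-Lipschitz Hessian, $L>0$. For the iterates $\bm{x}^k$ of the Adaptive Inertial Method write $\bm{g}^k=\nabla f(\bm{x}^k)$ (nonzero), $\mathrm{H}_k=\nabla^2 f(\bm{x}^k)$, $\theta_k=\sqrt{L\|\bm{g}^k\|}$, and let $p_k(t)=a_{k,0}+a_{k,1}t+\cdots+a_{k,n-1}t^{n-1}+t^n$ be the characteristic polynomial of $\mathrm{H}_k$ (so $p_k(\mathrm{H}_k)=0$). Let $q_k(t)=b_{k,0}+b_{k,1}t+\cdots+b_{k,n-1}t^{n-1}$ be a polynomial of degree $n-1$, choose the inertial term $\bm{m}^k=q_k(\mathrm{H}_k)\bm{g}^k$, and set $$r_k=\frac{(\bm{g}^k)^\top q_k(\mathrm{H}_k)^2\bm{g}^k}{(\bm{g}^k)^\top q_k(\mathrm{H}_k)\bm{g}^k}.$$ Suppose that for each $k$ the coefficients of $q_k$ satisfy $$b_{k,n-1}=1,\qquad b_{k,j}=a_{k,j+1}-\theta_k b_{k,j+1}\ \ (j=n-2,\dots,1),\qquad b_{k,0}=a_{k,1}-\theta_k b_{k,1}+\frac{r_k}{\mu_k},$$ and that the step size is $$\beta_k=\frac{1}{\theta_k+\frac{\mu_k}{r_k}(a_{k,0}-\theta_k b_{k,0})}.$$ Then the Adaptive Inertial Method coincides with the regularized Newton method, provided both are initialized at the same starting point; that is, at every $k$ the Adaptive Inertial Method update satisfies $$\bm{x}^{k+1}=\bm{x}^k-(\theta_k\mathrm{I}_n+\mathrm{H}_k)^{-1}\bm{g}^k,$$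 so the two methods generate the same sequence of iterates.
   Context: The Adaptive Inertial Method update with step size $\beta_k$, parameter $\mu_k\in[0,1)$ and nonzero inertial term $\bm{m}^k\in\mathbb{R}^n$ is $$\bm{x}^{k+1}=\bm{x}^k-\beta_k\nabla f(\bm{x}^k)+\gamma_k\bm{m}^k,\qquad \gamma_k=\mu_k\frac{(\bm{m}^k)^\top\nabla f(\bm{x}^k)}{\|\bm{m}^k\|^2}\beta_k.$$ With $\bm{m}^k=q_k(\mathrm{H}_k)\bm{g}^k$ this is $\bm{x}^{k+1}=\bm{x}^k-\beta_k\big(\mathrm{I}_n-\frac{\mu_k}{r_k}q_k(\mathrm{H}_k)\big)\bm{g}^k$. The relations among $r_k$, $\mu_k$, $b_{k,0}$ and $\beta_k$ are understood as a system of equations assumed to hold, with all quantities well defined: $\mu_k\in(0,1)$, $\bm{m}^k\ne 0$, $(\bm{g}^k)^\top q_k(\mathrm{H}_k)\bm{g}^k\neq 0$, and the denominator in $\beta_k$ nonzero. The step size is here prescribed directly by the formula in the statement. The regularized Newton method is the iteration $\bm{x}^{k+1}=\bm{x}^k-(\theta_k\mathrm{I}_n+\mathrm{H}_k)^{-1}\bm{g}^k$ with $\theta_k=\sqrt{L\|\bm{g}^k\|}$, $\bm{g}^k=\nabla f(\bm{x}^k)$, $\mathrm{H}_k=\nabla^2 f(\bm{x}^k)$, where the Hessian is $2L$-Lipschitz: $\|\nabla^2 f(\bm{x})-\nabla^2 f(\bm{y})\|\le 2L\|\bm{x}-\bm{y}\|$ for all $\bm{x},\bm{y}\in\mathbb{R}^n$.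 $\|\cdot\|$ is the Euclidean norm (operator norm for matrices) and $\mathrm{I}_n$ the identity matrix. *)

theory Defs
  imports "HOL-Analysis.Analysis" "HOL-Computational_Algebra.Polynomial"
begin

definition gradient :: "(real^'n \<Rightarrow> real) \<Rightarrow> real^'n \<Rightarrow> real^'n" where
  "gradient f x = (THE D. GDERIV f x :> D)"

lemma gradient_eqI:
  assumes "GDERIV f x :> D"
  shows "gradient f x = D"
  unfolding gradient_def
proof (rule the_equality)
  show "GDERIV f x :> D" by fact
  fix E assume "GDERIV f x :> E"
  with assms have "(\<lambda>h. h \<bullet> D) = (\<lambda>h. h \<bullet> E)"
    unfolding gderiv_def by (rule has_derivative_unique)
  then show "E = D" by (metis vector_eq_ldot)
qed

definition hessian :: "(real^'n \<Rightarrow> real) \<Rightarrow> real^'n \<Rightarrow> real^'n^'n" where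
  "hessian f x = jacobian (gradient f) (at x)"

definition twice_differentiable :: "(real^'n \<Rightarrow> real) \<Rightarrow> bool" where
  "twice_differentiable f \<longleftrightarrow>
     (\<forall>x. f differentiable (at x)) \<and> (\<forall>x. gradient f differentiable (at x))"

text \<open>The characteristic polynomial is \<open>det (t I - A)\<close>, hence monic.\<close>

definition charpoly :: "real^'n^'n \<Rightarrow> real poly" where
  "charpoly A = det (mat [:0, 1:] - map_matrix (\<lambda>c. [:c:]) A)"

text \<open>Powers and polynomials of a matrix are formed with the matrix product \<open>**\<close>;
  the type-class multiplication on \<open>real^'n^'n\<close>, and hence its \<open>^\<close>, would be componentwise.\<close>

definition matrix_pow :: "real^'n^'n \<Rightarrow> nat \<Rightarrow> real^'n^'n" where
  "matrix_pow A i = (((**) A) ^^ i) (mat 1)"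

definition poly_matrix :: "real poly \<Rightarrow> real^'n^'n \<Rightarrow> real^'n^'n" where
  "poly_matrix q A = (\<Sum>i\<le>degree q. coeff q i *\<^sub>R matrix_pow A i)"

definition aim_step ::
  "(real^'n \<Rightarrow> real) \<Rightarrow> real \<Rightarrow> real \<Rightarrow> real^'n \<Rightarrow> real^'n \<Rightarrow> real^'n" where
  "aim_step f \<beta> \<mu> m x =
     (let \<gamma> = \<mu> * ((m \<bullet> gradient f x) / (norm m)\<^sup>2) * \<beta>
      in x - \<beta> *\<^sub>R gradient f x + \<gamma> *\<^sub>R m)"

definition newton_reg :: "(real^'n \<Rightarrow> real) \<Rightarrow> real \<Rightarrow> real^'n \<Rightarrow> real" where
  "newton_reg f L x = sqrt (L * norm (gradient f x))"

definition reg_newton_step :: "(real^'n \<Rightarrow> real) \<Rightarrow> real \<Rightarrow> real^'n \<Rightarrow> real^'n" where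
  "reg_newton_step f L x =
     x - matrix_inv (mat (newton_reg f L x) + hessian f x) *v gradient f x"

end

theory Submission
  imports Defs
begin

text \<open>Drop the index \<open>k\<close> and write \<open>c = r / \<mu>\<close>. The recursion for the coefficients of \<open>q\<close> is synthetic
  division of the characteristic polynomial by \<open>t + \<theta>\<close>, perturbed by \<open>c\<close> in the last coefficient:
  \<open>p(t) = (t + \<theta>) q(t) - c t + (a\<^sub>0 - \<theta> b\<^sub>0)\<close>. By Cayley-Hamilton \<open>p(H) = 0\<close>, hence
  \<open>(\<theta> I + H) (I - q(H) / c) = (\<theta> + (a\<^sub>0 - \<theta> b\<^sub>0) / c) I = I / \<beta>\<close>, so that
  \<open>\<beta> (I - q(H) / c)\<close> is the inverse of \<open>\<theta> I + H\<close>. Symmetry of the Hessian turns \<open>g\<^sup>T q(H)\<^sup>2 g\<close> into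
  \<open>\<parallel>m\<parallel>\<^sup>2\<close>; this gives \<open>r \<noteq> 0\<close> and identifies the inertial coefficient \<open>\<gamma>\<close> with \<open>\<beta> / c\<close>.\<close>

section \<open>Symmetry of the Hessian\<close>

text \<open>A derivative with real values is a linear functional; its representing vector is the
  adjoint evaluated at \<open>1\<close>.\<close>

lemma gderiv_gradient:
  fixes f :: "real^'n \<Rightarrow> real"
  assumes "f differentiable (at x)"
  shows "GDERIV f x :> gradient f x"
proof -
  obtain f' where f': "(f has_derivative f') (at x)"
    using assms by (auto simp: differentiable_def)
  then have "linear f'" by (rule has_derivative_linear)
  then have "f' = (\<lambda>h. h \<bullet> adjoint f' 1)"
    by (simp add: adjoint_works)
  with f' have "GDERIV f x :> adjoint f' 1"
    by (simp add: gderiv_def)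
  then show ?thesis by (metis gradient_eqI)
qed

text \<open>Differentiability of \<open>G\<close> at the single point \<open>x\<close> suffices: the mean value theorem, applied in the
  direction \<open>u\<close> only, reduces the second difference to first differences of \<open>G\<close> near \<open>x\<close>.\<close>

lemma second_difference_bound:
  fixes f :: "real^'n \<Rightarrow> real" and A :: "real^'n^'n"
  assumes f: "\<And>y. GDERIV f y :> G y"
    and G: "(G has_derivative ((*v) A)) (at x)"
    and e: "e > 0"
  shows "\<exists>d>0. \<forall>t. 0 < t \<and> t < d \<longrightarrow>
    \<bar>f (x + t *\<^sub>R u + t *\<^sub>R v) - f (x + t *\<^sub>R u) - f (x + t *\<^sub>R v) + f x - t\<^sup>2 * (u \<bullet> (A *v v))\<bar> \<le> e * t\<^sup>2"
proof -
  \<comment> \<open>The estimate at the end of the proof yields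
    \<open>2 * norm u * S * (\<epsilon> * t\<^sup>2)\<close>, so \<epsilon> is \<open>e\<close>
    divided by a bound on the factor in front; the first \<open>+ 1\<close> keeps that bound
    positive for \<open>u = 0\<close>.\<close>
  define K where "K = 2 * (norm u + 1) * (norm u + norm v + 1)"
  have K: "K > 0" unfolding K_def
    by (intro mult_pos_pos) (auto intro: add_nonneg_pos)
  define \<epsilon> where "\<epsilon> = e / K"
  have \<epsilon>: "\<epsilon> > 0" using e K by (simp add: \<epsilon>_def)
  obtain d where d: "d > 0"
    and Gd: "\<And>y. norm (y - x) < d \<Longrightarrow> norm (G y - G x - A *v (y - x)) \<le> \<epsilon> * norm (y - x)"
    using G \<epsilon> unfolding has_derivative_at_alt by blast
  \<comment> \<open>Both displacements from \<open>x\<close> occurring below have norm at most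
    \<open>t * S\<close>, so \<open>t < d / S\<close> keeps them in the ball where \<open>Gd\<close>
    applies.\<close>
  define S where "S = norm u + norm v + 1"
  have S: "S > 0" by (simp add: S_def add_nonneg_pos)
  have *: "\<bar>f (x + t *\<^sub>R u + t *\<^sub>R v) - f (x + t *\<^sub>R u) - f (x + t *\<^sub>R v) + f x - t\<^sup>2 * (u \<bullet> (A *v v))\<bar> \<le> e * t\<^sup>2"
    if t: "0 < t" "t < d / S" for t
  proof -
    \<comment> \<open>The second difference is \<open>?\<phi> t - ?\<phi> 0\<close>: the shift by
      \<open>t *\<^sub>R v\<close> is frozen and only the direction \<open>u\<close> varies.\<close>
    let ?\<phi> = "\<lambda>s. f (x + s *\<^sub>R u + t *\<^sub>R v) - f (x + s *\<^sub>R u)"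
    let ?\<phi>' = "\<lambda>s. u \<bullet> (G (x + s *\<^sub>R u + t *\<^sub>R v) - G (x + s *\<^sub>R u))"
    have der: "(?\<phi> has_real_derivative ?\<phi>' s) (at s)" for s
    proof -
      have fd: "((\<lambda>s. f (w + s *\<^sub>R u)) has_real_derivative u \<bullet> G (w + s *\<^sub>R u)) (at s)" for w
      proof -
        have "((\<lambda>s. w + s *\<^sub>R u) has_derivative (\<lambda>h. h *\<^sub>R u)) (at s)"
          by (auto intro!: derivative_eq_intros)
        from has_derivative_compose[OF this f[unfolded gderiv_def]]
        show ?thesis
          by (simp add: has_field_derivative_def mult.commute[of _ "u \<bullet> _"])
      qed
      have "((\<lambda>s. f ((x + t *\<^sub>R v) + s *\<^sub>R u) - f (x + s *\<^sub>R u)) has_real_derivative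
              u \<bullet> G ((x + t *\<^sub>R v) + s *\<^sub>R u) - u \<bullet> G (x + s *\<^sub>R u)) (at s)"
        by (intro DERIV_diff fd)
      then show ?thesis by (simp add: inner_diff_right add_ac)
    qed
    obtain z where z: "0 < z" "z < t" and eq: "?\<phi> t - ?\<phi> 0 = (t - 0) * ?\<phi>' z"
      using MVT2[of 0 t ?\<phi> ?\<phi>'] t der by blast
    define R where "R y = G y - G x - A *v (y - x)" for y
    have R: "norm (R (x + h)) \<le> \<epsilon> * (t * S)" if "norm h \<le> t * S" for h
    proof -
      have "norm h \<le> t * S" by fact
      moreover have "t * S < d" using t S by (simp add: field_simps)
      ultimately have "norm (R (x + h)) \<le> \<epsilon> * norm h"
        using Gd[of "x + h"] by (simp add: R_def)
      also have "\<dots> \<le> \<epsilon> * (t * S)" using that \<epsilon> by simp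
      finally show ?thesis .
    qed
    have zu: "norm (z *\<^sub>R u) \<le> t * norm u" using z by (simp add: mult_right_mono)
    have tv: "norm (t *\<^sub>R v) = t * norm v" using t by simp
    have n1: "norm (z *\<^sub>R u + t *\<^sub>R v) \<le> t * S"
      using norm_triangle_ineq[of "z *\<^sub>R u" "t *\<^sub>R v"] zu tv t by (simp add: S_def algebra_simps)
    have n2: "norm (z *\<^sub>R u) \<le> t * S"
    proof -
      have "t * norm u \<le> t * S" using t by (intro mult_left_mono) (auto simp: S_def)
      with zu show ?thesis by (rule order_trans)
    qed
    have "norm (R (x + (z *\<^sub>R u + t *\<^sub>R v)) - R (x + z *\<^sub>R u)) \<le> 2 * (\<epsilon> * (t * S))"
      using norm_triangle_ineq4[of "R (x + (z *\<^sub>R u + t *\<^sub>R v))" "R (x + z *\<^sub>R u)"] R[OF n1] R[OF n2]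
      by simp
    then have Rd: "\<bar>u \<bullet> (R (x + (z *\<^sub>R u + t *\<^sub>R v)) - R (x + z *\<^sub>R u))\<bar> \<le> norm u * (2 * (\<epsilon> * (t * S)))"
      by (meson Cauchy_Schwarz_ineq2 mult_left_mono norm_ge_zero order_trans)
    \<comment> \<open>The linear parts at the two points differ by
      \<open>t *\<^sub>R (A *v v)\<close>. The contribution of the unknown \<open>z\<close> cancels
      there and survives only in the remainders.\<close>
    have split: "?\<phi>' z = t * (u \<bullet> (A *v v)) + u \<bullet> (R (x + (z *\<^sub>R u + t *\<^sub>R v)) - R (x + z *\<^sub>R u))"
      by (simp add: R_def inner_diff_right inner_add_right matrix_vector_right_distrib add.assoc
          matrix_vector_mult_scaleR)
    have "f (x + t *\<^sub>R u + t *\<^sub>R v) - f (x + t *\<^sub>R u) - f (x + t *\<^sub>R v) + f x - t\<^sup>2 * (u \<bullet> (A *v v))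
        = t * (u \<bullet> (R (x + (z *\<^sub>R u + t *\<^sub>R v)) - R (x + z *\<^sub>R u)))"
      using eq unfolding split by (simp add: algebra_simps power2_eq_square)
    also have "\<bar>\<dots>\<bar> \<le> t * (norm u * (2 * (\<epsilon> * (t * S))))"
      using Rd t by (simp add: abs_mult)
    also have "\<dots> = (2 * norm u * S) * (\<epsilon> * t\<^sup>2)" by (simp add: power2_eq_square)
    also have "\<dots> \<le> K * (\<epsilon> * t\<^sup>2)"
      using \<epsilon> S by (intro mult_right_mono) (auto simp: K_def S_def)
    also have "\<dots> = e * t\<^sup>2" using K by (simp add: \<epsilon>_def)
    finally show ?thesis .
  qed
  moreover have "d / S > 0" using d S by simp
  ultimately show ?thesis by blast
qed

text \<open>The second difference is symmetric in \<open>u\<close> and \<open>v\<close>, yet after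
  division by \<open>t\<^sup>2\<close> it approximates both \<open>u \<bullet> (A *v v)\<close> and
  \<open>v \<bullet> (A *v u)\<close>, so these differ by less than any positive amount.\<close>

lemma symmetric_second_derivative:
  fixes f :: "real^'n \<Rightarrow> real" and A :: "real^'n^'n"
  assumes f: "\<And>y. GDERIV f y :> G y"
    and G: "(G has_derivative ((*v) A)) (at x)"
  shows "transpose A = A"
proof -
  have sym: "u \<bullet> (A *v v) = v \<bullet> (A *v u)" for u v
  proof -
    have "\<bar>u \<bullet> (A *v v) - v \<bullet> (A *v u)\<bar> \<le> e" if e: "e > 0" for e
    proof -
      obtain d1 d2 where "d1 > 0" "d2 > 0"
        and d1: "\<And>t. 0 < t \<and> t < d1 \<Longrightarrow>
          \<bar>f (x + t *\<^sub>R u + t *\<^sub>R v) - f (x + t *\<^sub>R u) - f (x + t *\<^sub>R v) + f x - t\<^sup>2 * (u \<bullet> (A *v v))\<bar> \<le> e/2 * t\<^sup>2"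
        and d2: "\<And>t. 0 < t \<and> t < d2 \<Longrightarrow>
          \<bar>f (x + t *\<^sub>R v + t *\<^sub>R u) - f (x + t *\<^sub>R v) - f (x + t *\<^sub>R u) + f x - t\<^sup>2 * (v \<bullet> (A *v u))\<bar> \<le> e/2 * t\<^sup>2"
        using second_difference_bound[OF f G, of "e/2" u v]
          second_difference_bound[OF f G, of "e/2" v u] e by (auto simp del: times_divide_eq_left)
      define t where "t = min d1 d2 / 2"
      have t: "0 < t" "t < d1" "t < d2" using \<open>d1 > 0\<close> \<open>d2 > 0\<close> by (auto simp: t_def)
      define D where "D = f (x + t *\<^sub>R u + t *\<^sub>R v) - f (x + t *\<^sub>R u) - f (x + t *\<^sub>R v) + f x"
      have "\<bar>D - t\<^sup>2 * (u \<bullet> (A *v v))\<bar> \<le> e/2 * t\<^sup>2"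
        using d1[of t] t by (simp add: D_def)
      moreover have "\<bar>D - t\<^sup>2 * (v \<bullet> (A *v u))\<bar> \<le> e/2 * t\<^sup>2"
      proof -
        have "D = f (x + t *\<^sub>R v + t *\<^sub>R u) - f (x + t *\<^sub>R v) - f (x + t *\<^sub>R u) + f x"
          by (simp add: D_def add_ac)
        then show ?thesis using d2[of t] t by simp
      qed
      moreover have "e/2 * t\<^sup>2 + e/2 * t\<^sup>2 = t\<^sup>2 * e" by simp
      ultimately have "\<bar>t\<^sup>2 * (u \<bullet> (A *v v)) - t\<^sup>2 * (v \<bullet> (A *v u))\<bar> \<le> t\<^sup>2 * e"
        by linarith
      then have "t\<^sup>2 * \<bar>u \<bullet> (A *v v) - v \<bullet> (A *v u)\<bar> \<le> t\<^sup>2 * e"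
        by (simp add: abs_mult flip: right_diff_distrib)
      then show ?thesis using t by simp
    qed
    then show ?thesis
      by (meson abs_le_zero_iff dense_ge eq_iff_diff_eq_0)
  qed
  have "A $ i $ j = A $ j $ i" for i j
    using sym[of "axis i 1" "axis j 1"] by (simp add: inner_axis' matrix_vector_mul_component matrix_vector_mult_basis column_def)
  then show ?thesis by (simp add: transpose_def vec_eq_iff)
qed

lemma transpose_hessian:
  assumes "twice_differentiable f"
  shows "transpose (hessian f x) = hessian f x"
proof (rule symmetric_second_derivative)
  show "GDERIV f y :> gradient f y" for y
    using assms by (simp add: twice_differentiable_def gderiv_gradient)
  show "(gradient f has_derivative (*v) (hessian f x)) (at x)"
    using assms by (simp add: twice_differentiable_def hessian_def jacobian_works)
qed

section \<open>Polynomials of a matrix\<close>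

lemma matrix_pow_0 [simp]: "matrix_pow A 0 = mat 1"
  by (simp add: matrix_pow_def)

lemma matrix_pow_Suc: "matrix_pow A (Suc i) = A ** matrix_pow A i"
  by (simp add: matrix_pow_def)

text \<open>Transposition reverses products, so powers of a symmetric matrix need the factor on
  either side; the telescoping sum for Cayley-Hamilton needs this too.\<close>

lemma matrix_pow_Suc2: "matrix_pow A (Suc i) = matrix_pow A i ** A"
  by (induction i) (simp_all add: matrix_pow_Suc matrix_mul_assoc)

lemma transpose_matrix_pow:
  "transpose A = A \<Longrightarrow> transpose (matrix_pow A i) = matrix_pow A i"
  by (induction i)
    (simp_all add: transpose_mat matrix_pow_Suc matrix_transpose_mul flip: matrix_pow_Suc2)

text \<open>Padding with zero coefficients lets polynomials of different degrees share one summation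
  range.\<close>

lemma poly_matrix_altdef:
  assumes "degree q \<le> N"
  shows "poly_matrix q A = (\<Sum>i\<le>N. coeff q i *\<^sub>R matrix_pow A i)"
  unfolding poly_matrix_def
  using assms by (intro sum.mono_neutral_left) (auto simp: coeff_eq_0)

lemma transpose_poly_matrix:
  assumes "transpose A = A"
  shows "transpose (poly_matrix q A) = poly_matrix q A"
proof -
  have "transpose (poly_matrix q A) = (\<Sum>i\<le>degree q. coeff q i *\<^sub>R transpose (matrix_pow A i))"
    by (simp add: poly_matrix_def transpose_def vec_eq_iff)
  then show ?thesis
    using assms by (simp add: transpose_matrix_pow poly_matrix_def)
qed

lemma poly_matrix_add: "poly_matrix (p + q) A = poly_matrix p A + poly_matrix q A"
  using poly_matrix_altdef[of "p + q" "max (degree p) (degree q)" A]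
    poly_matrix_altdef[of p "max (degree p) (degree q)" A]
    poly_matrix_altdef[of q "max (degree p) (degree q)" A]
  by (simp add: degree_add_le_max scaleR_add_left sum.distrib)

lemma poly_matrix_smult: "poly_matrix (smult c p) A = c *\<^sub>R poly_matrix p A"
  using poly_matrix_altdef[of "smult c p" "degree p" A]
  by (simp add: poly_matrix_def degree_smult_le scaleR_sum_right)

lemma matrix_mul_scaleR_right: "A ** (c *\<^sub>R B) = c *\<^sub>R (A ** B)"
  for A :: "real^'n^'m" and B :: "real^'k^'n"
  by (simp add: matrix_matrix_mult_def vec_eq_iff sum_distrib_left mult_ac)

lemma matrix_mul_scaleR_left: "(c *\<^sub>R A) ** B = c *\<^sub>R (A ** B)"
  for A :: "real^'n^'m" and B :: "real^'k^'n"
  by (simp add: matrix_matrix_mult_def vec_eq_iff sum_distrib_left mult_ac)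

lemma matrix_mul_sum_right: "A ** (\<Sum>i\<in>S. B i) = (\<Sum>i\<in>S. A ** B i)"
  for A :: "real^'n^'m" and B :: "'b \<Rightarrow> real^'k^'n"
  by (induction S rule: infinite_finite_induct) (simp_all add: matrix_add_ldistrib)

lemma matrix_mul_diff_right: "A ** (B - C) = A ** B - A ** C"
  for A :: "real^'n^'m" and B C :: "real^'k^'n"
  by (simp add: matrix_matrix_mult_def vec_eq_iff right_diff_distrib sum_subtractf)

lemma matrix_mul_add_left: "(A + B) ** C = A ** C + B ** C"
  for A B :: "real^'n^'m" and C :: "real^'k^'n"
  by (simp add: matrix_matrix_mult_def vec_eq_iff distrib_right sum.distrib)

lemma poly_matrix_pCons:
  "poly_matrix (pCons c p) A = c *\<^sub>R mat 1 + A ** poly_matrix p A"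
proof -
  have "poly_matrix (pCons c p) A = (\<Sum>i\<le>Suc (degree p). coeff (pCons c p) i *\<^sub>R matrix_pow A i)"
    by (rule poly_matrix_altdef) (rule degree_pCons_le)
  also have "\<dots> = c *\<^sub>R mat 1 + (\<Sum>i\<le>degree p. coeff p i *\<^sub>R matrix_pow A (Suc i))"
    by (simp add: sum.atMost_Suc_shift del: sum.atMost_Suc)
  finally show ?thesis
    by (simp add: poly_matrix_def matrix_mul_sum_right matrix_mul_scaleR_right matrix_pow_Suc)
qed

section \<open>The characteristic polynomial\<close>

text \<open>In the Leibniz expansion a permutation other than the identity picks a constant
  off-diagonal entry at some moved index, so its product has degree below \<open>CARD('n)\<close>.
  The diagonal product alone decides these coefficients, and it is monic of degree
  \<open>CARD('n)\<close>.\<close>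

lemma coeff_charpoly_ge:
  fixes A :: "real^'n^'n"
  assumes "CARD('n) \<le> j"
  shows "coeff (charpoly A) j = (if j = CARD('n) then 1 else 0)"
proof -
  define M where "M = mat [:0, 1:] - map_matrix (\<lambda>c. [:c:]) A"
  have diag: "M $ i $ i = [:- (A $ i $ i), 1:]" for i
    by (simp add: M_def map_matrix_def mat_def)
  have off: "M $ i $ k = [:- (A $ i $ k):]" if "i \<noteq> k" for i k
    using that by (simp add: M_def map_matrix_def mat_def)
  have "coeff (of_int (sign \<pi>) * (\<Prod>i\<in>UNIV. M $ i $ \<pi> i)) j = 0"
    if \<pi>: "\<pi> \<noteq> id" for \<pi>
  proof -
    obtain i where i: "\<pi> i \<noteq> i" using \<pi> by (auto simp: fun_eq_iff)
    have "degree (\<Prod>i\<in>UNIV. M $ i $ \<pi> i) \<le> (\<Sum>i\<in>UNIV. degree (M $ i $ \<pi> i))"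
      using degree_prod_sum_le[of UNIV "\<lambda>i. M $ i $ \<pi> i"] by (simp add: o_def)
    also have "\<dots> < (\<Sum>i\<in>(UNIV :: 'n set). 1)"
    proof (rule sum_strict_mono_ex1)
      have "degree (M $ i $ \<pi> i) \<le> 1" for i
        by (cases "\<pi> i = i") (simp_all add: diag off)
      then show "\<forall>i\<in>UNIV. degree (M $ i $ \<pi> i) \<le> 1" by blast
      show "\<exists>i\<in>UNIV. degree (M $ i $ \<pi> i) < 1"
        using i by (intro bexI[of _ i]) (simp_all add: off)
    qed simp
    finally have "degree (\<Prod>i\<in>UNIV. M $ i $ \<pi> i) < j" using assms by simp
    then have "coeff (\<Prod>i\<in>UNIV. M $ i $ \<pi> i) j = 0" by (rule coeff_eq_0)
    then show ?thesis by (simp add: sign_def)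
  qed
  then have "coeff (charpoly A) j = coeff (\<Prod>i\<in>UNIV. M $ i $ i) j"
    unfolding charpoly_def M_def[symmetric] det_def coeff_sum
    by (subst sum.remove[of _ id])
      (auto simp: finite_permutations permutes_id sign_id
        intro!: sum.neutral)
  moreover have "degree (\<Prod>i\<in>UNIV. M $ i $ i) = CARD('n)"
    unfolding diag by (subst degree_prod_eq_sum_degree) auto
  moreover have "lead_coeff (\<Prod>i\<in>UNIV. M $ i $ i) = 1"
    unfolding diag by (subst lead_coeff_prod) auto
  ultimately show ?thesis using assms by (auto intro: coeff_eq_0)
qed

text \<open>The right inverse up to \<open>det A\<close> is the adjugate, written with row replacement
  in place of cofactors.\<close>

lemma matrix_mul_adjugate:
  fixes A :: "'a::comm_ring_1^'n^'n"
  shows "\<exists>B. A ** B = mat (det A)"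
proof
  let ?B = "\<chi> k j. det (\<chi> r. if r = j then axis k 1 else row r A)"
  have "(A ** ?B) $ i $ j = mat (det A) $ i $ j" for i j
  proof -
    have "(A ** ?B) $ i $ j
        = (\<Sum>k\<in>UNIV. det (\<chi> r. if r = j then A $ i $ k *s axis k 1 else row r A))"
      by (simp add: matrix_matrix_mult_def det_row_mul)
    \<comment> \<open>Linearity in row \<open>j\<close> gathers the sum over \<open>k\<close> into
      row \<open>i\<close> of \<open>A\<close>: the result is \<open>A\<close> itself for
      \<open>i = j\<close> and has two equal rows otherwise.\<close>
    also have "\<dots> = det (\<chi> r. if r = j then (\<Sum>k\<in>UNIV. A $ i $ k *s axis k 1) else row r A)"
      by (rule det_linear_row_sum[symmetric]) simp
    also have "(\<Sum>k\<in>UNIV. A $ i $ k *s axis k 1) = row i A"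
      by (simp add: basis_expansion row_def vec_eq_iff)
    also have "det (\<chi> r. if r = j then row i A else row r A) = mat (det A) $ i $ j"
    proof (cases "i = j")
      case True
      then have "(\<chi> r. if r = j then row i A else row r A) = A"
        by (auto simp: vec_eq_iff row_def)
      then show ?thesis using True by (simp add: mat_def)
    next
      case False
      then have "det (\<chi> r. if r = j then row i A else row r A) = 0"
        by (intro det_identical_rows[of i j]) (auto simp: row_def vec_eq_iff)
      then show ?thesis using False by (simp add: mat_def)
    qed
    finally show ?thesis .
  qed
  then show "A ** ?B = mat (det A)" by (simp add: vec_eq_iff)
qed

text \<open>Comparing coefficients in \<open>(t I - A) B(t) = p(t) I\<close>, with \<open>B(t) = \<Sum>\<^sub>l t\<^sup>l C\<^sub>l\<close>, makes \<open>p(A)\<close> telescope.\<close>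

theorem Cayley_Hamilton:
  fixes A :: "real^'n^'n"
  shows "poly_matrix (charpoly A) A = 0"
proof -
  let ?M = "mat [:0, 1:] - map_matrix (\<lambda>c. [:c:]) A"
  obtain B where B: "?M ** B = mat (charpoly A)"
    using matrix_mul_adjugate[of ?M] by (auto simp: charpoly_def)
  define C :: "nat \<Rightarrow> real^'n^'n" where "C l = (\<chi> i j. coeff (B $ i $ j) l)" for l
  let ?a = "coeff (charpoly A)"
  have entry: "pCons 0 (B $ i $ j) - (\<Sum>k\<in>UNIV. smult (A $ i $ k) (B $ k $ j))
      = (if i = j then charpoly A else 0)" for i j
  proof -
    have "(?M ** B) $ i $ j
        = (\<Sum>k\<in>UNIV. (if i = k then [:0, 1:] else 0) * B $ k $ j - smult (A $ i $ k) (B $ k $ j))"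
      by (simp add: matrix_matrix_mult_def mat_def map_matrix_def algebra_simps)
    also have "\<dots> = (\<Sum>k\<in>UNIV. if i = k then pCons 0 (B $ k $ j) else 0)
        - (\<Sum>k\<in>UNIV. smult (A $ i $ k) (B $ k $ j))"
      by (subst sum_subtractf[symmetric]) (auto intro!: sum.cong)
    also have "\<dots> = pCons 0 (B $ i $ j) - (\<Sum>k\<in>UNIV. smult (A $ i $ k) (B $ k $ j))"
      by simp
    finally show ?thesis using B by (simp add: mat_def)
  qed
  have C0: "?a 0 *\<^sub>R mat 1 = - (A ** C 0)"
  proof -
    have "?a 0 * (if i = j then 1 else 0) = - (\<Sum>k\<in>UNIV. A $ i $ k * C 0 $ k $ j)" for i j
      using arg_cong[OF entry[of i j], of "\<lambda>p. coeff p 0"] by (auto simp: C_def coeff_sum)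
    then show ?thesis by (simp add: vec_eq_iff mat_def matrix_matrix_mult_def)
  qed
  have CSuc: "?a (Suc l) *\<^sub>R mat 1 = C l - A ** C (Suc l)" for l
  proof -
    have "?a (Suc l) * (if i = j then 1 else 0) = C l $ i $ j - (\<Sum>k\<in>UNIV. A $ i $ k * C (Suc l) $ k $ j)" for i j
      using arg_cong[OF entry[of i j], of "\<lambda>p. coeff p (Suc l)"] by (auto simp: C_def coeff_sum)
    then show ?thesis by (simp add: vec_eq_iff mat_def matrix_matrix_mult_def)
  qed
  have telescope: "(\<Sum>i\<le>l. ?a i *\<^sub>R matrix_pow A i) = - (matrix_pow A (Suc l) ** C l)" for l
  proof (induction l)
    case 0
    show ?case using C0 by (simp add: matrix_pow_Suc)
  next
    case (Suc l)
    have "?a (Suc l) *\<^sub>R matrix_pow A (Suc l) = matrix_pow A (Suc l) ** (?a (Suc l) *\<^sub>R mat 1)"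
      by (simp add: matrix_mul_scaleR_right)
    also have "\<dots> = matrix_pow A (Suc l) ** C l - matrix_pow A (Suc (Suc l)) ** C (Suc l)"
      by (simp add: CSuc matrix_mul_diff_right matrix_mul_assoc matrix_pow_Suc2[of A "Suc l"])
    finally show ?case using Suc by simp
  qed
  \<comment> \<open>\<open>N\<close> is at least the degree of the characteristic polynomial, so the
    partial sum up to \<open>N\<close> is complete, and it exceeds the degree of every entry of
    \<open>B\<close>, so the term left over by telescoping vanishes.\<close>
  define N where "N = Suc (degree (charpoly A) + (\<Sum>i\<in>UNIV. \<Sum>j\<in>UNIV. degree (B $ i $ j)))"
  have "degree (B $ i $ j) < N" for i j
  proof -
    have "degree (B $ i $ j) \<le> (\<Sum>j\<in>UNIV. degree (B $ i $ j))"
      by (rule member_le_sum) auto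
    also have "\<dots> \<le> (\<Sum>i\<in>UNIV. \<Sum>j\<in>UNIV. degree (B $ i $ j))"
      by (rule member_le_sum[of _ _ "\<lambda>i. \<Sum>j\<in>UNIV. degree (B $ i $ j)"]) auto
    finally show ?thesis by (simp add: N_def)
  qed
  then have "C N = 0" by (simp add: C_def vec_eq_iff coeff_eq_0)
  moreover have "poly_matrix (charpoly A) A = (\<Sum>i\<le>N. ?a i *\<^sub>R matrix_pow A i)"
    by (rule poly_matrix_altdef) (simp add: N_def)
  ultimately show ?thesis by (simp add: telescope)
qed

section \<open>The two iterations\<close>

lemma charpoly_eq_shifted_mult:
  fixes A :: "real^'n^'n" and q :: "real poly"
  assumes n: "CARD('n) > 1"
    and deg: "degree q = CARD('n) - 1"
    and lead: "coeff q (CARD('n) - 1) = 1"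
    and mid: "\<forall>j\<in>{1..CARD('n) - 2}.
                coeff q j = coeff (charpoly A) (j + 1) - \<theta> * coeff q (j + 1)"
    and zero: "coeff q 0 = coeff (charpoly A) 1 - \<theta> * coeff q 1 + c"
  shows "charpoly A
    = pCons 0 q + smult \<theta> q + [:coeff (charpoly A) 0 - \<theta> * coeff q 0, - c:]"
proof (rule poly_eqI)
  fix j
  let ?n = "CARD('n)"
  \<comment> \<open>The correction term touches only degrees 0 and 1. In between, \<open>mid\<close>
    is read one index lower because \<open>pCons\<close> shifts \<open>q\<close>; at
    \<open>CARD('n)\<close> both sides are monic, and above it both vanish.\<close>
  consider "j = 0" | "j = 1" | i where "j = Suc i" "i \<in> {1..?n - 2}" | "j = ?n" "j \<ge> 2" | "j > ?n"
  proof (cases "j \<ge> 2 \<and> j < ?n")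
    case True
    then have "j = Suc (j - 1)" "j - 1 \<in> {1..?n - 2}" by auto
    then show ?thesis by (rule that(3))
  next
    case False
    then have "j = 0 \<or> j = 1 \<or> j = ?n \<and> j \<ge> 2 \<or> j > ?n" using n by linarith
    then show ?thesis using that(1,2,4,5) by blast
  qed
  then show "coeff (charpoly A) j
    = coeff (pCons 0 q + smult \<theta> q + [:coeff (charpoly A) 0 - \<theta> * coeff q 0, - c:]) j"
  proof cases
    case 1
    then show ?thesis by simp
  next
    case 2
    then show ?thesis using zero by simp
  next
    case 3
    then obtain i' where "i = Suc i'" by (cases i) auto
    then show ?thesis using 3 mid by simp
  next
    case 4
    then obtain i where i: "?n = Suc (Suc i)"
      using n by (metis Suc_less_eq2 One_nat_def gr0_implies_Suc)
    then have "coeff q (Suc (Suc i)) = 0" using deg by (intro coeff_eq_0) simp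
    then show ?thesis using 4 i lead coeff_charpoly_ge[of j A] by simp
  next
    case 5
    then have "j = Suc (Suc (j - 2))" using n by linarith
    then obtain i where i: "j = Suc (Suc i)" ..
    have "coeff q (Suc i) = 0" "coeff q (Suc (Suc i)) = 0"
      using deg 5 i n by (auto intro!: coeff_eq_0)
    then show ?thesis using 5 i coeff_charpoly_ge[of j A] by simp
  qed
qed

text \<open>For square matrices a right inverse is two-sided, so a single product identifies the
  inverse.\<close>

lemma matrix_inv_eqI:
  fixes A :: "real^'n^'n"
  assumes "A ** B = mat 1"
  shows "invertible A" "matrix_inv A = B"
proof -
  show inv: "invertible A" using assms by (auto simp: invertible_right_inverse)
  then have "matrix_inv A ** A = mat 1"
    unfolding invertible_def matrix_inv_def by (rule someI2_ex) simp
  then have "matrix_inv A ** (A ** B) = B"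
    by (simp add: matrix_mul_assoc)
  then show "matrix_inv A = B" using assms by simp
qed

theorem theorem3p3:
  fixes f :: "real^'n \<Rightarrow> real"
    and L :: real
    and x g m :: "nat \<Rightarrow> real^'n"
    and H :: "nat \<Rightarrow> real^'n^'n"
    and p q :: "nat \<Rightarrow> real poly"
    and \<beta> \<mu> \<theta> r :: "nat \<Rightarrow> real"
  assumes n: "CARD('n) > 1"
    and L: "L > 0"
    and convex: "convex_on UNIV f"
    and diff: "twice_differentiable f"
    and grad_lipschitz: "\<exists>M. M-lipschitz_on UNIV (gradient f)"
    and hess_lipschitz:
      "\<forall>u v. onorm ((*v) (hessian f u - hessian f v)) \<le> 2 * L * norm (u - v)"
    and g: "\<forall>k. g k = gradient f (x k)"
    and H: "\<forall>k. H k = hessian f (x k)"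
    and \<theta>: "\<forall>k. \<theta> k = sqrt (L * norm (g k))"
    and p: "\<forall>k. p k = charpoly (H k)"
    and m: "\<forall>k. m k = poly_matrix (q k) (H k) *v g k"
    and r: "\<forall>k. r k = (g k \<bullet> (matrix_pow (poly_matrix (q k) (H k)) 2 *v g k))
                     / (g k \<bullet> (poly_matrix (q k) (H k) *v g k))"
    and g_nonzero: "\<forall>k. g k \<noteq> 0"
    and \<mu>: "\<forall>k. 0 < \<mu> k \<and> \<mu> k < 1"
    and m_nonzero: "\<forall>k. m k \<noteq> 0"
    and r_denom: "\<forall>k. g k \<bullet> (poly_matrix (q k) (H k) *v g k) \<noteq> 0"
    and deg_q: "\<forall>k. degree (q k) = CARD('n) - 1"
    and b_lead: "\<forall>k. coeff (q k) (CARD('n) - 1) = 1"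
    and b_mid: "\<forall>k. \<forall>j\<in>{1..CARD('n) - 2}.
                  coeff (q k) j = coeff (p k) (j + 1) - \<theta> k * coeff (q k) (j + 1)"
    and b_zero: "\<forall>k. coeff (q k) 0 = coeff (p k) 1 - \<theta> k * coeff (q k) 1 + r k / \<mu> k"
    and \<beta>_denom:
      "\<forall>k. \<theta> k + \<mu> k / r k * (coeff (p k) 0 - \<theta> k * coeff (q k) 0) \<noteq> 0"
    and \<beta>:
      "\<forall>k. \<beta> k = 1 / (\<theta> k + \<mu> k / r k * (coeff (p k) 0 - \<theta> k * coeff (q k) 0))"
    and aim: "\<forall>k. x (Suc k) = aim_step f (\<beta> k) (\<mu> k) (m k) (x k)"
  shows "(\<forall>k. invertible (mat (\<theta> k) + H k) \<and>
              x (Suc k) = x k - matrix_inv (mat (\<theta> k) + H k) *v g k)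
       \<and> (\<forall>y. y 0 = x 0 \<and> (\<forall>k. y (Suc k) = reg_newton_step f L (y k)) \<longrightarrow> y = x)"
proof -
  have step: "invertible (mat (\<theta> k) + H k) \<and>
      x (Suc k) = x k - matrix_inv (mat (\<theta> k) + H k) *v g k" for k
  proof -
    define Q where "Q = poly_matrix (q k) (H k)"
    define \<delta> where "\<delta> = coeff (p k) 0 - \<theta> k * coeff (q k) 0"
    define s where "s = \<mu> k / r k"
    have "transpose Q = Q"
      unfolding Q_def using transpose_hessian[OF diff] H by (simp add: transpose_poly_matrix)
    have mQ: "m k = Q *v g k" using m by (simp add: Q_def)
    have "g k \<bullet> (matrix_pow Q 2 *v g k) = g k \<bullet> (Q *v (Q *v g k))"
      by (simp add: numeral_2_eq_2 matrix_pow_Suc matrix_vector_mul_assoc)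
    also have "\<dots> = m k \<bullet> m k"
      using \<open>transpose Q = Q\<close> by (metis mQ dot_lmul_matrix vector_transpose_matrix)
    finally have rk: "r k = (m k \<bullet> m k) / (m k \<bullet> g k)"
      using r mQ by (simp add: Q_def inner_commute)
    have mg: "m k \<bullet> g k \<noteq> 0" using r_denom m by (simp add: inner_commute)
    then have r0: "r k \<noteq> 0" using rk m_nonzero by simp
    have \<mu>0: "\<mu> k \<noteq> 0" using \<mu> by (metis less_irrefl)
    have p': "p k = pCons 0 (q k) + smult (\<theta> k) (q k) + [:\<delta>, - (r k / \<mu> k):]"
      unfolding \<delta>_def p[rule_format]
      by (rule charpoly_eq_shifted_mult) (use n deg_q b_lead b_mid b_zero p in auto)
    have lin: "poly_matrix [:a, b:] (H k) = a *\<^sub>R mat 1 + b *\<^sub>R H k" for a b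
      by (simp add: poly_matrix_def matrix_pow_Suc)
    have "poly_matrix (p k) (H k) = 0" using p by (simp add: Cayley_Hamilton)
    then have "H k ** Q + \<theta> k *\<^sub>R Q + \<delta> *\<^sub>R mat 1 - (r k / \<mu> k) *\<^sub>R H k = 0"
      unfolding p' poly_matrix_add poly_matrix_smult lin poly_matrix_pCons[of 0] Q_def
      by (simp add: algebra_simps)
    then have "s *\<^sub>R (H k ** Q + \<theta> k *\<^sub>R Q + \<delta> *\<^sub>R mat 1 - (r k / \<mu> k) *\<^sub>R H k) = 0"
      by simp
    \<comment> \<open>Scaling by \<open>s\<close>, the reciprocal of \<open>r k / \<mu> k\<close>,
      gives \<open>H k\<close> coefficient 1. The left side is then the product of
      \<open>mat (\<theta> k) + H k\<close> with \<open>s *\<^sub>R Q\<close>, and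
      \<open>H k\<close> cancels when it is subtracted below.\<close>
    then have key: "s *\<^sub>R (H k ** Q) + (s * \<theta> k) *\<^sub>R Q = H k - (s * \<delta>) *\<^sub>R mat 1"
      using r0 \<mu>0 by (simp add: s_def algebra_simps)
    have mat_\<theta>: "mat (\<theta> k) = \<theta> k *\<^sub>R (mat 1 :: real^'n^'n)"
      by (simp add: mat_def vec_eq_iff)
    have \<beta>k: "\<beta> k * (\<theta> k + s * \<delta>) = 1"
      using \<beta> \<beta>_denom by (simp add: s_def \<delta>_def)
    define W where "W = \<beta> k *\<^sub>R (mat 1 - s *\<^sub>R Q)"
    have "(mat (\<theta> k) + H k) ** (mat 1 - s *\<^sub>R Q)
        = \<theta> k *\<^sub>R mat 1 + H k - (s *\<^sub>R (H k ** Q) + (s * \<theta> k) *\<^sub>R Q)"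
      by (simp add: mat_\<theta> matrix_mul_diff_right matrix_mul_add_left matrix_mul_scaleR_left
          matrix_mul_scaleR_right scaleR_add_right algebra_simps)
    also have "\<dots> = (\<theta> k + s * \<delta>) *\<^sub>R mat 1"
      unfolding key by (simp add: scaleR_add_left)
    finally have "(mat (\<theta> k) + H k) ** W = mat 1"
      using \<beta>k by (simp add: W_def matrix_mul_scaleR_right)
    note inv = matrix_inv_eqI[OF this]
    \<comment> \<open>By \<open>rk\<close>, the quotient of \<open>m k \<bullet> g k\<close> by the
      squared norm of \<open>m k\<close> is \<open>1 / r k\<close>.\<close>
    have "\<mu> k * ((m k \<bullet> g k) / (norm (m k))\<^sup>2) * \<beta> k = \<beta> k * s"
      by (simp add: s_def rk power2_norm_eq_inner)
    then have "x (Suc k) = x k - \<beta> k *\<^sub>R g k + (\<beta> k * s) *\<^sub>R (Q *v g k)"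
      using aim g by (simp add: aim_step_def mQ)
    also have "\<dots> = x k - W *v g k"
      by (simp add: W_def matrix_vector_mult_diff_rdistrib scaleR_diff_right
          flip: scaleR_matrix_vector_assoc)
    finally show ?thesis using inv by simp
  qed
  \<comment> \<open>Once the iterates agree at \<open>k\<close>, so do gradient, Hessian and
    regularization there, and \<open>step\<close> gives agreement at \<open>Suc k\<close>.\<close>
  have "y = x" if y0: "y 0 = x 0" and y: "\<forall>k. y (Suc k) = reg_newton_step f L (y k)" for y
  proof
    fix k show "y k = x k"
    proof (induction k)
      case (Suc k)
      then show ?case
        using step[of k] y g H \<theta> by (simp add: reg_newton_step_def newton_reg_def)
    qed (rule y0)
  qed
  with step show ?thesis by blast
qed

end
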